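(* Let $n\ge1$, $\delta>0$ and $\beta=n$. Let $f\in H^{s_1}(\mathbf{T}^n)$ and $g\in H^{s_2}(\mathbf{T}^n)$ with $s_1>n$ and $s_2>n$. Let $$u(x,t)=(\hat f_0+\hat g_0t)+\sum_{0\ne k\in\mathbb{Z}^n}\left[\hat f_k\cos(\sqrt{-m_k}\,t)+\frac{\hat g_k}{\sqrt{-m_k}}\sin(\sqrt{-m_k}\,t)\right]e^{ik\cdot x}.$$ Then $u(x,\cdot)\in C^\infty[0,\infty)$ (in the sense of classical derivatives in $t$) for any $x\in\mathbf{T}^n$.
   Context: For $k\in\mathbb{Z}^n$, $m_k=m^{\delta,\beta}(k)$, where for $\nu\in\mathbb{R}^n$ $$m^{\delta,\beta}(\nu)=-\|\nu\|^2\,{}_2F_3\!\left(1,\tfrac{n+2-\beta}{2};2,\tfrac{n+2}{2},\tfrac{n+4-\beta}{2};-\tfrac14\|\nu\|^2\delta^2\right),$$ ${}_2F_3(a_1,a_2;b_1,b_2,b_3;z)=\sum_{j\ge0}\frac{(a_1)_j(a_2)_j}{(b_1)_j(b_2)_j(b_3)_j}\frac{z^j}{j!}$, $(a)_j=a(a+1)\cdots(a+j-1)$; one has $m_k<0$ for all $k\neq0$. $\mathbf{T}^n=\prod_{j=1}^n[0,2\pi]$ is the periodic torus; a periodic distribution $g$ is written $g=\sum_{k\in\mathbb{Z}^n}\hat g_ke^{ik\cdot x}$ with Fourier coefficients $\hat g_k$; for $q\in\mathbb{R}$, $H^q(\mathbf{T}^n)$ is the space of periodic distributions with $\sum_{k\in\mathbb{Z}^n}(1+\|k\|^2)^q|\hat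 g_k|^2<\infty$. *)

theory Defs
  imports "HOL-Analysis.Analysis"
begin

definition hypergeom_2F3 :: "real \<Rightarrow> real \<Rightarrow> real \<Rightarrow> real \<Rightarrow> real \<Rightarrow> real \<Rightarrow> real" where
  "hypergeom_2F3 a1 a2 b1 b2 b3 z =
     (\<Sum>j. (pochhammer a1 j * pochhammer a2 j) /
           (pochhammer b1 j * pochhammer b2 j * pochhammer b3 j) * (z ^ j / fact j))"

definition multiplier :: "real \<Rightarrow> real \<Rightarrow> real ^ 'n \<Rightarrow> real" where
  "multiplier \<delta> \<beta> \<nu> =
     (let n = real CARD('n) in
      - ((norm \<nu>)\<^sup>2) *
        hypergeom_2F3 1 ((n + 2 - \<beta>) / 2) 2 ((n + 2) / 2) ((n + 4 - \<beta>) / 2)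
          (- (1 / 4) * (norm \<nu>)\<^sup>2 * \<delta>\<^sup>2))"

definition freq :: "int ^ 'n \<Rightarrow> real ^ 'n" where
  "freq k = (\<chi> i. real_of_int (k $ i))"

definition torus :: "(real ^ 'n) set" where
  "torus = {x. \<forall>i. 0 \<le> x $ i \<and> x $ i \<le> 2 * pi}"

definition partial :: "'n \<Rightarrow> (real ^ 'n \<Rightarrow> complex) \<Rightarrow> real ^ 'n \<Rightarrow> complex" where
  "partial i \<phi> x = frechet_derivative \<phi> (at x) (axis i 1)"

abbreviation partials :: "'n list \<Rightarrow> (real ^ 'n \<Rightarrow> complex) \<Rightarrow> real ^ 'n \<Rightarrow> complex" where
  "partials is \<phi> \<equiv> foldr partial is \<phi>"

text \<open>The test functions on the torus, as smooth functions on the whole space of period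
  \<open>2 \<pi>\<close> in each coordinate. Requiring every iterated partial derivative (including the
  function itself, for the empty list) to be Frechet differentiable is the same as \<open>C\<^sup>\<infinity>\<close>.\<close>

definition periodic_test :: "(real ^ 'n \<Rightarrow> complex) set" where
  "periodic_test =
     {\<phi>. (\<forall>is x. partials is \<phi> differentiable (at x)) \<and>
         (\<forall>i x. \<phi> (x + axis i (2 * pi)) = \<phi> x)}"

text \<open>A periodic distribution is a linear functional on the test functions that is continuous
  for uniform convergence of all derivatives; the space of test functions is metrizable, so
  sequential continuity suffices, and by linearity it is enough to have it at \<open>0\<close>. Values of
  the functional outside \<^const>\<open>periodic_test\<close> are irrelevant.\<close>

definition periodic_distribution :: "((real ^ 'n \<Rightarrow> complex) \<Rightarrow> complex) \<Rightarrow> bool" where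
  "periodic_distribution F \<longleftrightarrow>
     (\<forall>\<phi>\<in>periodic_test. \<forall>\<psi>\<in>periodic_test. F (\<lambda>x. \<phi> x + \<psi> x) = F \<phi> + F \<psi>) \<and>
     (\<forall>c. \<forall>\<phi>\<in>periodic_test. F (\<lambda>x. c * \<phi> x) = c * F \<phi>) \<and>
     (\<forall>\<Phi> :: nat \<Rightarrow> real ^ 'n \<Rightarrow> complex.
        (\<forall>j. \<Phi> j \<in> periodic_test) \<longrightarrow>
        (\<forall>is. uniform_limit UNIV (\<lambda>j. partials is (\<Phi> j)) (\<lambda>_. 0) sequentially) \<longrightarrow>
        (\<lambda>j. F (\<Phi> j)) \<longlonglongrightarrow> 0)"

text \<open>A function \<open>h\<close> on the torus is identified with the functional
  \<open>\<phi> \<mapsto> \<integral> h \<phi>\<close> (no normalizing factor), so that the coefficients of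
  \<open>h = \<Sum> h\<^sub>k exp (i k \<bullet> x)\<close> are obtained with the factor \<open>(2 \<pi>)\<close> to the power \<open>-n\<close>.\<close>

definition fourier_coeff :: "((real ^ 'n \<Rightarrow> complex) \<Rightarrow> complex) \<Rightarrow> int ^ 'n \<Rightarrow> complex" where
  "fourier_coeff F k = F (\<lambda>x. cis (- (freq k \<bullet> x))) / of_real ((2 * pi) ^ CARD('n))"

definition sobolev :: "real \<Rightarrow> ((real ^ 'n \<Rightarrow> complex) \<Rightarrow> complex) set" where
  "sobolev q =
     {F. periodic_distribution F \<and>
         (\<lambda>k. (1 + (norm (freq k))\<^sup>2) powr q * (cmod (fourier_coeff F k))\<^sup>2) summable_on UNIV}"

definition solution_mode ::
  "real \<Rightarrow> real \<Rightarrow> ((real ^ 'n \<Rightarrow> complex) \<Rightarrow> complex) \<Rightarrow> ((real ^ 'n \<Rightarrow> complex) \<Rightarrow> complex)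
     \<Rightarrow> real ^ 'n \<Rightarrow> real \<Rightarrow> int ^ 'n \<Rightarrow> complex" where
  "solution_mode \<delta> \<beta> f g x t k =
     (let w = sqrt (- multiplier \<delta> \<beta> (freq k)) in
      (fourier_coeff f k * of_real (cos (w * t)) +
       fourier_coeff g k / of_real w * of_real (sin (w * t))) * cis (freq k \<bullet> x))"

definition solution ::
  "real \<Rightarrow> real \<Rightarrow> ((real ^ 'n \<Rightarrow> complex) \<Rightarrow> complex) \<Rightarrow> ((real ^ 'n \<Rightarrow> complex) \<Rightarrow> complex)
     \<Rightarrow> real ^ 'n \<Rightarrow> real \<Rightarrow> complex" where
  "solution \<delta> \<beta> f g x t =
     (fourier_coeff f 0 + fourier_coeff g 0 * of_real t) +
     (\<Sum>\<^sub>\<infinity>k\<in>UNIV - {0}. solution_mode \<delta> \<beta> f g x t k)"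

text \<open>\<open>D j\<close> is the classical \<open>j\<close>-th derivative; it is one-sided at a boundary point of \<open>S\<close>,
  where \<open>S\<close> is meant to be a nondegenerate interval.\<close>

definition C_infinity_on :: "real set \<Rightarrow> (real \<Rightarrow> complex) \<Rightarrow> bool" where
  "C_infinity_on S h \<longleftrightarrow>
     (\<exists>D :: nat \<Rightarrow> real \<Rightarrow> complex. D 0 = h \<and>
        (\<forall>j. \<forall>t\<in>S. (D j has_vector_derivative D (Suc j) t) (at t within S)))"

end

theory Submission
  imports Defs
begin

text \<open>For \<open>\<beta> = n\<close> the multiplier grows only logarithmically. Put \<open>b = n / 2\<close>. Then
  \<open>m(\<nu>) = - (4 / \<delta>\<^sup>2) L(\<parallel>\<nu>\<parallel>\<^sup>2 \<delta>\<^sup>2 / 4)\<close> with \<open>y L'(y) = b (1 - F(y))\<close>, where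
  \<open>F(y)\<close> is \<open>\<^sub>0F\<^sub>1(; b; -y)\<close>. The equation \<open>y F'' + b F' + F = 0\<close> makes the energy
  \<open>F\<^sup>2 + y F'\<^sup>2\<close> nonincreasing because \<open>b \<ge> 1/2\<close>, hence \<open>\<bar>F\<bar> \<le> 1\<close> and
  \<open>\<bar>L(y)\<bar> \<le> C + 2 b ln (1 + y)\<close>. Every power of \<open>\<bar>m\<^sub>k\<bar>\<close> is therefore \<open>O((1 + \<parallel>k\<parallel>\<^sup>2)\<^sup>\<epsilon>)\<close> for
  each \<open>\<epsilon> > 0\<close>; taking \<open>\<epsilon> = s - n\<close> and using
  \<open>(1 + \<parallel>k\<parallel>\<^sup>2)\<^sup>n \<ge> (1 + k\<^sub>1\<^sup>2) \<dots> (1 + k\<^sub>n\<^sup>2)\<close>, the Fourier coefficients stay absolutely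
  summable after multiplication by any power of \<open>\<bar>m\<^sub>k\<bar>\<close>, and the series can be differentiated
  term by term. No lower bound for \<open>\<bar>m\<^sub>k\<bar>\<close> is needed, as \<open>\<bar>sin (w t) / w\<bar> \<le> \<bar>t\<bar>\<close>.\<close>

section \<open>The entire series \<open>F01\<close> and \<open>log_series\<close>\<close>

definition F01_coeff :: "real \<Rightarrow> nat \<Rightarrow> real" where
  "F01_coeff b j = (-1) ^ j / (pochhammer b j * fact j)"

text \<open>For y > 0 this is Gamma(b) y^((1-b)/2) J_(b-1)(2 sqrt y), with J the Bessel function;
  for b = 1/2 it is cos(2 sqrt y).\<close>

definition F01 :: "real \<Rightarrow> real \<Rightarrow> real" where
  "F01 b y = (\<Sum>j. F01_coeff b j * y ^ j)"

text \<open>This is the power series with value \<open>0\<close> at \<open>0\<close> that solves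
  \<open>y L'(y) = b (1 - F01 b y)\<close>; the coefficient of index \<open>0\<close> is \<open>0\<close> as a division by \<open>0\<close>.\<close>

definition log_coeff :: "real \<Rightarrow> nat \<Rightarrow> real" where
  "log_coeff b j = - b * F01_coeff b j / real j"

definition log_series :: "real \<Rightarrow> real \<Rightarrow> real" where
  "log_series b y = (\<Sum>j. log_coeff b j * y ^ j)"

text \<open>Only the first factor \<open>b\<close> of the product can lie below 1; the factors
  \<open>b + i\<close> with i >= 1 exceed 1.\<close>

lemma pochhammer_ge_half:
  fixes b :: real
  assumes "b \<ge> 1/2"
  shows "pochhammer b j \<ge> 1/2"
proof (induction j)
  case (Suc j)
  show ?case
  proof (cases j)
    case 0
    then show ?thesis using assms by simp
  next
    case (Suc i)
    then have "1 \<le> b + real j" using assms by simp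
    then have "pochhammer b j * 1 \<le> pochhammer b j * (b + real j)"
      using Suc.IH by (intro mult_left_mono) auto
    then show ?thesis unfolding pochhammer_Suc using Suc.IH by linarith
  qed
qed simp

lemma F01_coeff_bound:
  assumes "b \<ge> 1/2"
  shows "\<bar>F01_coeff b j\<bar> \<le> 2 / fact j"
proof -
  have p: "pochhammer b j \<ge> 1/2"
    using assms by (rule pochhammer_ge_half)
  have "\<bar>F01_coeff b j\<bar> = (1 / pochhammer b j) * (1 / fact j)"
    using p by (simp add: F01_coeff_def abs_mult power_abs)
  also have "\<dots> \<le> 2 * (1 / fact j)"
    using p by (intro mult_right_mono) (auto simp: field_simps)
  finally show ?thesis by simp
qed

text \<open>The equation y F'' + b F' + F = 0, read off coefficient by coefficient.\<close>

lemma F01_coeff_rec: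
  assumes "b > 0"
  shows "real (Suc j) * (b + real j) * F01_coeff b (Suc j) = - F01_coeff b j"
proof -
  have "pochhammer b j > 0" "b + real j > 0"
    using assms by (auto intro: pochhammer_pos)
  then show ?thesis
    by (simp add: F01_coeff_def pochhammer_Suc divide_simps del: of_nat_Suc)
qed

lemma summable_exp_bounded:
  fixes c :: "nat \<Rightarrow> real"
  assumes "\<And>j. \<bar>c j\<bar> \<le> C / fact j"
  shows "summable (\<lambda>j. c j * y ^ j)"
proof (rule summable_comparison_test)
  have "summable (\<lambda>j. inverse (fact j) * \<bar>y\<bar> ^ j)"
    by (rule summable_exp)
  then show "summable (\<lambda>j. C * (inverse (fact j) * \<bar>y\<bar> ^ j))"
    by (rule summable_mult)
  show "\<exists>N. \<forall>n\<ge>N. norm (c n * y ^ n) \<le> C * (inverse (fact n) * \<bar>y\<bar> ^ n)"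
    using mult_right_mono[OF assms, of "\<bar>y\<bar> ^ _"]
    by (auto simp: abs_mult power_abs divide_inverse mult.assoc)
qed

lemma summable_F01:
  assumes "b \<ge> 1/2"
  shows "summable (\<lambda>j. F01_coeff b j * y ^ j)"
  using F01_coeff_bound[OF assms] by (rule summable_exp_bounded)

lemma summable_log_series:
  assumes "b \<ge> 1/2"
  shows "summable (\<lambda>j. log_coeff b j * y ^ j)"
proof (rule summable_exp_bounded[where C = "2 * b"])
  fix j
  have "\<bar>log_coeff b j\<bar> = b * (\<bar>F01_coeff b j\<bar> / real j)"
    using assms by (simp add: log_coeff_def abs_mult)
  \<comment> \<open>For j = 0 the quotient is 0 by the convention on division; for j >= 1 the
    divisor is at least 1.\<close>
  also have "\<dots> \<le> b * \<bar>F01_coeff b j\<bar>"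
    using assms by (intro mult_left_mono) (auto simp: divide_simps mult_left_mono mult_le_cancel_left1)
  also have "\<dots> \<le> b * (2 / fact j)"
    using assms F01_coeff_bound[OF assms] by (intro mult_left_mono) auto
  finally show "\<bar>log_coeff b j\<bar> \<le> 2 * b / fact j" by (simp add: mult.commute[of b])
qed

text \<open>For y >= 0 the energy \<open>E\<close> dominates F^2, and it never rises above E(0) = 1.
  At b = 1/2 it is constant.\<close>

lemma abs_F01_le_1:
  assumes b: "b \<ge> 1/2" and y: "y \<ge> 0"
  shows "\<bar>F01 b y\<bar> \<le> 1"
proof -
  define c where "c = F01_coeff b"
  define F1 where "F1 y = (\<Sum>j. diffs c j * y ^ j)" for y
  define F2 where "F2 y = (\<Sum>j. diffs (diffs c) j * y ^ j)" for y
  have s0: "summable (\<lambda>j. c j * y ^ j)" for y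
    unfolding c_def using b by (rule summable_F01)
  then have s1: "summable (\<lambda>j. diffs c j * y ^ j)" for y
    by (rule termdiff_converges_all)
  then have s2: "summable (\<lambda>j. diffs (diffs c) j * y ^ j)" for y
    by (rule termdiff_converges_all)
  have d0: "(F01 b has_field_derivative F1 y) (at y)" for y
    using termdiffs_strong_converges_everywhere[OF s0] unfolding F1_def F01_def[abs_def] c_def .
  have d1: "(F1 has_field_derivative F2 y) (at y)" for y
    using termdiffs_strong_converges_everywhere[OF s1] unfolding F1_def[abs_def] F2_def .
  have ode: "y * F2 y + b * F1 y + F01 b y = 0" for y
  proof -
    \<comment> \<open>Multiplying F'' by y shifts its series by one index; \<open>G\<close> holds
      the shifted terms, with 0 at index 0, so that the three series can be added term by
      term.\<close>
    define G where "G j = (case j of 0 \<Rightarrow> 0 | Suc i \<Rightarrow> diffs (diffs c) i * y ^ Suc i)" for j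
    have G: "G 0 = 0" "G (Suc i) = y * (diffs (diffs c) i * y ^ i)" for i
      by (simp_all add: G_def)
    have z: "G j + b * (diffs c j * y ^ j) + c j * y ^ j = 0" for j
    proof -
      have "(real j * real (Suc j) * c (Suc j) + b * (real (Suc j) * c (Suc j)) + c j) * y ^ j = 0"
        using F01_coeff_rec[of b j] b by (simp add: c_def algebra_simps)
      then show ?thesis
        by (cases j) (simp_all add: G diffs_def algebra_simps)
    qed
    have "(\<lambda>i. y * (diffs (diffs c) i * y ^ i)) sums (y * F2 y)"
      unfolding F2_def by (intro sums_mult summable_sums s2)
    then have a: "G sums (y * F2 y)"
      using sums_Suc_iff[of G] by (simp add: G)
    have "(\<lambda>j. G j + b * (diffs c j * y ^ j) + c j * y ^ j) sums (y * F2 y + b * F1 y + F01 b y)"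
      unfolding F1_def F01_def c_def[symmetric]
      by (intro sums_add a sums_mult summable_sums s0 s1)
    then show ?thesis
      by (simp only: z) (metis sums_unique2 sums_zero)
  qed
  define E where "E y = (F01 b y)\<^sup>2 + y * (F1 y)\<^sup>2" for y
  have dE: "(E has_field_derivative (1 - 2 * b) * (F1 y)\<^sup>2) (at y)" for y
  proof -
    have "(E has_field_derivative
        2 * F01 b y * F1 y + ((F1 y)\<^sup>2 + y * (2 * F1 y * F2 y))) (at y)"
      unfolding E_def[abs_def] by (auto intro!: derivative_eq_intros d0 d1)
    \<comment> \<open>Inserting y F'' = -b F' - F cancels the mixed terms F F'.\<close>
    also have "2 * F01 b y * F1 y + ((F1 y)\<^sup>2 + y * (2 * F1 y * F2 y)) = (1 - 2 * b) * (F1 y)\<^sup>2"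
      using ode[of y] by algebra
    finally show ?thesis .
  qed
  have "E y \<le> E 0"
  proof (rule DERIV_nonpos_imp_nonincreasing[OF y])
    fix x
    show "\<exists>D. (E has_real_derivative D) (at x) \<and> D \<le> 0"
      using dE[of x] b by (auto intro!: exI mult_nonpos_nonneg)
  qed
  moreover have "E 0 = 1"
    unfolding E_def F01_def powser_zero by (simp add: F01_coeff_def)
  ultimately have "(F01 b y)\<^sup>2 \<le> 1"
    using y unfolding E_def by (smt (verit) mult_nonneg_nonneg zero_le_power2)
  then show ?thesis
    by (simp add: abs_square_le_1)
qed

text \<open>Termwise differentiation yields a factor j that cancels the division in
  \<open>log_coeff\<close>; what remains is -b times the series of \<open>F01\<close> without its
  constant term 1. Stating the equation for \<open>y * D\<close> includes y = 0.\<close>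

lemma log_series_has_derivative:
  assumes b: "b \<ge> 1/2"
  obtains D where "(log_series b has_real_derivative D) (at y)" "y * D = b * (1 - F01 b y)"
proof
  let ?c = "log_coeff b"
  have s0: "summable (\<lambda>j. ?c j * y ^ j)" for y
    using b by (rule summable_log_series)
  show "(log_series b has_real_derivative (\<Sum>j. diffs ?c j * y ^ j)) (at y)"
    using termdiffs_strong_converges_everywhere[OF s0] unfolding log_series_def[abs_def] .
  have "(\<lambda>j. y * (diffs ?c j * y ^ j)) sums (y * (\<Sum>j. diffs ?c j * y ^ j))"
    by (intro sums_mult summable_sums termdiff_converges_all s0)
  moreover have "(\<lambda>j. y * (diffs ?c j * y ^ j)) sums (b * (1 - F01 b y))"
  proof -
    have "(\<lambda>j. F01_coeff b j * y ^ j) sums F01 b y"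
      unfolding F01_def by (rule summable_sums[OF summable_F01[OF b]])
    then have "(\<lambda>j. F01_coeff b (Suc j) * y ^ Suc j) sums (F01 b y - 1)"
      using sums_Suc_iff[of "\<lambda>j. F01_coeff b j * y ^ j"] by (simp add: F01_coeff_def)
    then have "(\<lambda>j. - b * (F01_coeff b (Suc j) * y ^ Suc j)) sums (- b * (F01 b y - 1))"
      by (rule sums_mult)
    moreover have "- b * (F01_coeff b (Suc j) * y ^ Suc j) = y * (diffs ?c j * y ^ j)" for j
      by (simp add: diffs_def log_coeff_def)
    ultimately show ?thesis
      by (simp add: algebra_simps)
  qed
  ultimately show "y * (\<Sum>j. diffs ?c j * y ^ j) = b * (1 - F01 b y)"
    by (rule sums_unique2)
qed

text \<open>Since |F01| <= 1, the derivative is at most 2b/y in absolute value, which integrates to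
  2b ln y from 1 on. The singularity of 1/y at 0 is avoided by compactness of [0, 1].\<close>

lemma log_series_bound:
  assumes b: "b \<ge> 1/2"
  obtains C where "C \<ge> 0" "\<And>y. y \<ge> 0 \<Longrightarrow> \<bar>log_series b y\<bar> \<le> C + 2 * b * ln (1 + y)"
proof -
  have "continuous_on {0..1} (log_series b)"
    by (intro continuous_at_imp_continuous_on ballI)
      (metis log_series_has_derivative[OF b] DERIV_isCont)
  then have "compact (log_series b ` {0..1})"
    by (intro compact_continuous_image) auto
  then obtain C where C: "\<And>y. y \<in> {0..1} \<Longrightarrow> \<bar>log_series b y\<bar> \<le> C"
    by (metis bounded_iff compact_imp_bounded imageI real_norm_def)
  show ?thesis
  proof
    show "C \<ge> 0" using C[of 0] by auto
    fix y :: real assume y: "y \<ge> 0"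
    show "\<bar>log_series b y\<bar> \<le> C + 2 * b * ln (1 + y)"
    proof (cases "y \<le> 1")
      case True
      have "2 * b * ln (1 + y) \<ge> 0"
        using b y by (intro mult_nonneg_nonneg) auto
      then show ?thesis using C[of y] True y by auto
    next
      case False
      \<comment> \<open>The sign \<open>e\<close> = 1 or -1 treats the upper and the lower bound
        together: x times the derivative is b (2 + e (1 - F01)), which is nonnegative.\<close>
      have *: "\<exists>D. ((\<lambda>x. 2 * b * ln x + e * log_series b x) has_real_derivative D) (at x) \<and> 0 \<le> D"
        if x: "1 \<le> x" and e: "\<bar>e\<bar> = 1" for x e :: real
      proof -
        obtain D where D: "(log_series b has_real_derivative D) (at x)" "x * D = b * (1 - F01 b x)"
          using log_series_has_derivative[OF b] .
        have "\<bar>F01 b x\<bar> \<le> 1"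
          using b x by (intro abs_F01_le_1) auto
        then have "\<bar>e * (1 - F01 b x)\<bar> \<le> 2"
          using e by (simp add: abs_mult)
        then have "b * (2 + e * (1 - F01 b x)) \<ge> 0"
          using b by (intro mult_nonneg_nonneg) auto
        moreover have "x * (2 * b / x + e * D) = 2 * b + e * (x * D)"
          using x by (simp add: field_simps)
        ultimately have "x * (2 * b / x + e * D) \<ge> 0"
          unfolding D(2) by (simp add: algebra_simps)
        then have "2 * b / x + e * D \<ge> 0"
          using x by (simp add: zero_le_mult_iff)
        then show ?thesis
          using x by (intro exI[of _ "2 * b / x + e * D"])
            (auto intro!: derivative_eq_intros D(1))
      qed
      have **: "- e * log_series b y \<le> C + 2 * b * ln y" if e: "\<bar>e\<bar> = 1" for e
      proof -
        have "2 * b * ln 1 + e * log_series b 1 \<le> 2 * b * ln y + e * log_series b y"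
        proof (rule DERIV_nonneg_imp_nondecreasing[where f = "\<lambda>x. 2 * b * ln x + e * log_series b x"])
          show "1 \<le> y" using False by simp
        qed (rule *[OF _ e])
        moreover have "\<bar>e * log_series b 1\<bar> \<le> C"
          using C[of 1] e by (simp add: abs_mult)
        ultimately show ?thesis by simp
      qed
      have "\<bar>log_series b y\<bar> \<le> C + 2 * b * ln y"
        using **[of 1] **[of "-1"] by simp
      also have "\<dots> \<le> C + 2 * b * ln (1 + y)"
        using b False by (intro add_left_mono mult_left_mono) auto
      finally show ?thesis .
    qed
  qed
qed

section \<open>Logarithmic growth of the multiplier\<close>

text \<open>At \<open>\<beta>\<close> = n the parameters become 1, 1; 2, n/2 + 1, 2. With (1)_j =
  j!, (2)_j = (j+1)! and (b)_(j+1) = b (b+1)_j, x times the hypergeometric term of index j is the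
  term of index j + 1 of \<open>log_series\<close>.\<close>

lemma multiplier_eq_log_series:
  fixes \<nu> :: "real ^ 'n"
  assumes "\<delta> > 0"
  shows "multiplier \<delta> (real CARD('n)) \<nu> =
    - (4 / \<delta>\<^sup>2) * log_series (real CARD('n) / 2) ((norm \<nu>)\<^sup>2 * \<delta>\<^sup>2 / 4)"
proof -
  define b where "b = real CARD('n) / 2"
  define x where "x = (norm \<nu>)\<^sup>2 * \<delta>\<^sup>2 / 4"
  have b: "b \<ge> 1/2" by (simp add: b_def)
  have coeff: "(pochhammer 1 j * pochhammer 1 j) / (pochhammer 2 j * pochhammer (b + 1) j * pochhammer 2 j)
      * ((- x) ^ j / fact j) * x = log_coeff b (Suc j) * x ^ Suc j" for j
  proof -
    have p1: "pochhammer (1::real) j = fact j" by (simp add: pochhammer_fact)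
    have "pochhammer (1::real) (Suc j) = pochhammer 2 j"
      by (simp add: pochhammer_rec)
    then have p2: "pochhammer (2::real) j = fact (Suc j)"
      by (metis pochhammer_fact)
    have p3: "pochhammer b (Suc j) = b * pochhammer (b + 1) j"
      by (rule pochhammer_rec)
    have "pochhammer (b + 1) j > 0"
      using b by (intro pochhammer_pos) auto
    moreover have "(- x) ^ j = (-1) ^ j * x ^ j"
      by (rule power_minus)
    ultimately show ?thesis
      using b unfolding log_coeff_def F01_coeff_def p1 p2 p3
      by (simp add: field_simps del: of_nat_Suc)
  qed
  have "(\<lambda>j. log_coeff b j * x ^ j) sums log_series b x"
    unfolding log_series_def by (rule summable_sums[OF summable_log_series[OF b]])
  then have s: "(\<lambda>j. log_coeff b (Suc j) * x ^ Suc j) sums log_series b x"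
    using sums_Suc_iff[of "\<lambda>j. log_coeff b j * x ^ j"] by (simp add: log_coeff_def)
  have "x * hypergeom_2F3 1 1 2 (b + 1) 2 (- x) = log_series b x"
  proof (cases "x = 0")
    case True
    then show ?thesis
      using s by (simp add: sums_iff)
  next
    case False
    let ?t = "\<lambda>j. (pochhammer 1 j * pochhammer 1 j) / (pochhammer 2 j * pochhammer (b + 1) j * pochhammer 2 j)
      * ((- x) ^ j / fact j)"
    have "(\<lambda>j. ?t j * x / x) sums (log_series b x / x)"
      unfolding coeff by (rule sums_divide[OF s])
    then have "?t sums (log_series b x / x)"
      using False by simp
    then show ?thesis
      using False by (simp add: hypergeom_2F3_def sums_iff)
  qed
  moreover have "multiplier \<delta> (real CARD('n)) \<nu> = - (4 / \<delta>\<^sup>2) * (x * hypergeom_2F3 1 1 2 (b + 1) 2 (- x))"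
    using assms by (simp add: multiplier_def Let_def b_def x_def add_divide_distrib)
  ultimately show ?thesis
    by (simp add: b_def x_def)
qed

text \<open>A logarithm is bounded by any small power, ln v <= v^eta / eta, so its p-th power costs
  only v^(p eta).\<close>

lemma multiplier_power_bound:
  assumes "\<delta> > 0" "\<epsilon> > 0"
  obtains C where "C \<ge> 0"
    "\<And>\<nu> :: real ^ 'n. \<bar>multiplier \<delta> (real CARD('n)) \<nu>\<bar> ^ p \<le> C * (1 + (norm \<nu>)\<^sup>2) powr \<epsilon>"
proof -
  define b where "b = real CARD('n) / 2"
  have b: "b \<ge> 1/2" by (simp add: b_def)
  obtain C where C: "C \<ge> 0" "\<And>y. y \<ge> 0 \<Longrightarrow> \<bar>log_series b y\<bar> \<le> C + 2 * b * ln (1 + y)"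
    using log_series_bound[OF b] by blast
  \<comment> \<open>\<open>Suc p\<close> keeps the divisor positive at p = 0, and p times
    \<open>\<eta>\<close> still stays below \<open>\<epsilon>\<close>.\<close>
  define \<eta> where "\<eta> = \<epsilon> / real (Suc p)"
  have \<eta>: "\<eta> > 0" using assms by (simp add: \<eta>_def)
  define B where "B = (4 / \<delta>\<^sup>2) * (C + 2 * b * (ln (1 + \<delta>\<^sup>2) + 1 / \<eta>))"
  have B: "B \<ge> 0"
    unfolding B_def using C(1) b \<eta> by (intro mult_nonneg_nonneg add_nonneg_nonneg) auto
  show ?thesis
  proof
    show "B ^ p \<ge> 0" using B by simp
    fix \<nu> :: "real ^ 'n"
    define v where "v = 1 + (norm \<nu>)\<^sup>2"
    define x where "x = (norm \<nu>)\<^sup>2 * \<delta>\<^sup>2 / 4"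
    have v: "v \<ge> 1" and x: "x \<ge> 0" by (auto simp: v_def x_def)
    have vp: "v powr \<eta> \<ge> 1" using v \<eta> by (simp add: ge_one_powr_ge_zero)
    have "ln (1 + \<delta>\<^sup>2) * 1 \<le> ln (1 + \<delta>\<^sup>2) * v powr \<eta>"
      by (intro mult_left_mono vp) auto
    then have l0: "ln (1 + \<delta>\<^sup>2) \<le> ln (1 + \<delta>\<^sup>2) * v powr \<eta>"
      by simp
    \<comment> \<open>Separates the fixed \<open>\<delta>\<close> from the frequency, leaving only
      ln v to be estimated.\<close>
    have "1 + x \<le> (1 + \<delta>\<^sup>2) * v"
      by (simp add: v_def x_def algebra_simps)
    then have "ln (1 + x) \<le> ln ((1 + \<delta>\<^sup>2) * v)"
      using x by simp
    also have "\<dots> = ln (1 + \<delta>\<^sup>2) + ln v"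
      using v by (intro ln_mult_pos) (auto intro: add_pos_nonneg)
    also have "\<dots> \<le> ln (1 + \<delta>\<^sup>2) * v powr \<eta> + v powr \<eta> / \<eta>"
      by (intro add_mono ln_powr_bound[OF v \<eta>] l0)
    finally have l: "ln (1 + x) \<le> (ln (1 + \<delta>\<^sup>2) + 1 / \<eta>) * v powr \<eta>"
      by (simp add: algebra_simps)
    have "\<bar>multiplier \<delta> (real CARD('n)) \<nu>\<bar> = (4 / \<delta>\<^sup>2) * \<bar>log_series b x\<bar>"
      unfolding multiplier_eq_log_series[OF assms(1)] b_def x_def by (simp add: abs_mult)
    also have "\<dots> \<le> (4 / \<delta>\<^sup>2) * (C * v powr \<eta> + 2 * b * ((ln (1 + \<delta>\<^sup>2) + 1 / \<eta>) * v powr \<eta>))"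
    proof (intro mult_left_mono order_trans[OF C(2)[OF x]] add_mono l)
      show "C \<le> C * v powr \<eta>" using C(1) vp by (simp add: mult_le_cancel_left1)
    qed (use b in auto)
    also have "\<dots> = B * v powr \<eta>"
      by (simp add: B_def algebra_simps)
    finally have "\<bar>multiplier \<delta> (real CARD('n)) \<nu>\<bar> ^ p \<le> (B * v powr \<eta>) ^ p"
      by (intro power_mono) auto
    also have "\<dots> = B ^ p * v powr (\<eta> * real p)"
      using v by (simp add: power_mult_distrib powr_power mult.commute)
    also have "\<dots> \<le> B ^ p * v powr \<epsilon>"
      using v B assms by (intro mult_left_mono powr_mono) (auto simp: \<eta>_def field_simps)
    finally show "\<bar>multiplier \<delta> (real CARD('n)) \<nu>\<bar> ^ p \<le> B ^ p * (1 + (norm \<nu>)\<^sup>2) powr \<epsilon>"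
      by (simp add: v_def)
  qed
qed

section \<open>Summability over the frequency lattice\<close>

lemma summable_on_inverse_1_plus_square_int:
  "(\<lambda>m::int. 1 / (1 + (real_of_int m)\<^sup>2)) summable_on UNIV"
proof -
  let ?h = "\<lambda>m::int. 1 / (1 + (real_of_int m)\<^sup>2)"
  have "summable (\<lambda>n::nat. 1 / (1 + (real n)\<^sup>2))"
  \<comment> \<open>At n = 0 the majorant is 1/0 = 0, hence a comparison only from n = 1 on.\<close>
  proof (rule summable_comparison_test_ev)
    show "\<forall>\<^sub>F n in sequentially. norm (1 / (1 + (real n)\<^sup>2)) \<le> 1 / (real n)\<^sup>2"
      by (intro eventually_sequentiallyI[of 1]) (auto intro!: divide_left_mono mult_pos_pos add_pos_nonneg)
    show "summable (\<lambda>n. 1 / (real n)\<^sup>2)"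
      using inverse_power_summable[of 2, where ?'a = real] by (simp add: inverse_eq_divide)
  qed
  then have n: "(\<lambda>n::nat. 1 / (1 + (real n)\<^sup>2)) summable_on UNIV"
    by (subst summable_on_UNIV_nonneg_real_iff) auto
  have "?h summable_on (range int)"
    using n by (subst summable_on_reindex) (auto simp: o_def)
  moreover have "?h summable_on (range (\<lambda>n. - int n))"
    using n by (subst summable_on_reindex) (auto simp: o_def inj_on_def)
  ultimately have "?h summable_on (range int \<union> range (\<lambda>n. - int n))"
    by (rule summable_on_union)
  moreover have "range int \<union> range (\<lambda>n. - int n) = UNIV"
    by (metis (mono_tags, lifting) UNIV_eq_I UnCI int_cases2 rangeI)
  ultimately show ?thesis by simp
qed

text \<open>Each factor 1/(1 + |k|^2) is at most 1/(1 + k_i^2), so a product of one-dimensional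
  weights dominates.\<close>

lemma summable_on_freq_weight:
  "(\<lambda>k :: int ^ 'n. (1 + (norm (freq k))\<^sup>2) powr (- real CARD('n))) summable_on UNIV"
proof -
  define h where "h = (\<lambda>m::int. 1 / (1 + (real_of_int m)\<^sup>2))"
  have h0: "h m \<ge> 0" for m by (simp add: h_def)
  have hs: "h summable_on UNIV"
    unfolding h_def by (rule summable_on_inverse_1_plus_square_int)
  have "(\<lambda>k :: int ^ 'n. \<Prod>i\<in>UNIV. h (k $ i)) summable_on UNIV"
  proof (rule nonneg_bdd_above_summable_on)
    show "bdd_above (sum (\<lambda>k :: int ^ 'n. \<Prod>i\<in>UNIV. h (k $ i)) ` {F. F \<subseteq> UNIV \<and> finite F})"
    proof (rule bdd_aboveI2)
      fix F :: "(int ^ 'n) set" assume "F \<in> {F. F \<subseteq> UNIV \<and> finite F}"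
      then have F: "finite F" by simp
      \<comment> \<open>\<open>A\<close> holds every coordinate of every point of \<open>F\<close>;
        over the box of all vectors with entries in \<open>A\<close>, the sum of products
        factors.\<close>
      define A where "A = (\<Union>k\<in>F. range (\<lambda>i. k $ i))"
      have A: "finite A" unfolding A_def using F by auto
      have "(\<Sum>k\<in>F. \<Prod>i\<in>UNIV. h (k $ i)) = (\<Sum>g\<in>vec_nth ` F. \<Prod>i\<in>UNIV. h (g i))"
        by (subst sum.reindex) (auto simp: inj_on_def vec_nth_inject)
      also have "\<dots> \<le> (\<Sum>g\<in>PiE (UNIV :: 'n set) (\<lambda>_. A). \<Prod>i\<in>UNIV. h (g i))"
        using A by (intro sum_mono2 prod_nonneg) (auto simp: A_def h0 intro: finite_PiE)
      also have "\<dots> = (\<Prod>i\<in>(UNIV :: 'n set). \<Sum>m\<in>A. h m)"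
        using A by (subst prod_sum_PiE) auto
      also have "\<dots> \<le> (\<Prod>i\<in>(UNIV :: 'n set). infsum h UNIV)"
        using A h0 by (intro prod_mono conjI sum_nonneg finite_sum_le_infsum hs) auto
      finally show "(\<Sum>k\<in>F. \<Prod>i\<in>UNIV. h (k $ i)) \<le> (\<Prod>i\<in>(UNIV :: 'n set). infsum h UNIV)" .
    qed
  qed (auto intro: prod_nonneg h0)
  then show ?thesis
  proof (rule summable_on_comparison_test)
    fix k :: "int ^ 'n"
    define v where "v = 1 + (norm (freq k))\<^sup>2"
    have v: "v > 0" unfolding v_def by (intro add_pos_nonneg) auto
    have "1 / v \<le> h (k $ i)" for i
    proof -
      have "\<bar>freq k $ i\<bar> \<le> norm (freq k)" by (rule component_le_norm_cart)
      then have "(freq k $ i)\<^sup>2 \<le> (norm (freq k))\<^sup>2"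
        using abs_le_square_iff by fastforce
      then show ?thesis
        unfolding h_def v_def by (intro divide_left_mono mult_pos_pos add_pos_nonneg) (auto simp: freq_def)
    qed
    then have "(\<Prod>i\<in>(UNIV :: 'n set). 1 / v) \<le> (\<Prod>i\<in>UNIV. h (k $ i))"
      using v by (intro prod_mono) auto
    moreover have "v powr (- real CARD('n)) = (\<Prod>i\<in>(UNIV :: 'n set). 1 / v)"
      using v by (simp add: powr_minus powr_realpow power_divide inverse_eq_divide)
    ultimately show "(1 + (norm (freq k))\<^sup>2) powr (- real CARD('n)) \<le> (\<Prod>i\<in>UNIV. h (k $ i))"
      by (simp add: v_def)
  qed simp
qed

text \<open>By 2XY <= X^2 + Y^2 with weights v^(s/2) and v^(-s/2), the terms are dominated by v^s
  |f_k|^2, summable as f lies in H^s, plus v^(-s) |m_k|^p <= C v^(-n), where the multiplier bound is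
  taken with exponent s - n.\<close>

lemma sobolev_weighted_coeffs_summable:
  fixes f :: "(real ^ 'n \<Rightarrow> complex) \<Rightarrow> complex"
  assumes "\<delta> > 0" "f \<in> sobolev s" "s > real CARD('n)"
  shows "(\<lambda>k. \<bar>sqrt (- multiplier \<delta> (real CARD('n)) (freq k))\<bar> ^ p * cmod (fourier_coeff f k))
    summable_on UNIV"
proof -
  define m :: "int ^ 'n \<Rightarrow> real" where "m k = multiplier \<delta> (real CARD('n)) (freq k)" for k
  define v :: "int ^ 'n \<Rightarrow> real" where "v k = 1 + (norm (freq k))\<^sup>2" for k
  have v: "v k > 0" for k unfolding v_def by (intro add_pos_nonneg) auto
  obtain C where C: "C \<ge> 0"
    "\<And>\<nu> :: real ^ 'n. \<bar>multiplier \<delta> (real CARD('n)) \<nu>\<bar> ^ p \<le> C * (1 + (norm \<nu>)\<^sup>2) powr (s - real CARD('n))"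
    using multiplier_power_bound[of \<delta> "s - real CARD('n)"] assms by auto
  have f: "(\<lambda>k. v k powr s * (cmod (fourier_coeff f k))\<^sup>2) summable_on UNIV"
    using assms(2) by (simp add: sobolev_def v_def)
  have w: "(\<lambda>k. v k powr (- real CARD('n))) summable_on UNIV"
    unfolding v_def by (rule summable_on_freq_weight)
  have "(\<lambda>k. v k powr s * (cmod (fourier_coeff f k))\<^sup>2 + C * v k powr (- real CARD('n))) summable_on UNIV"
    by (intro summable_on_add f summable_on_cmult_right w)
  then show ?thesis
  proof (rule summable_on_comparison_test)
    fix k :: "int ^ 'n"
    let ?w = "\<bar>sqrt (- m k)\<bar> ^ p" and ?a = "cmod (fourier_coeff f k)"
    \<comment> \<open>The real \<open>sqrt\<close> is an odd function, so its square is the absolute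
      value for either sign of the argument.\<close>
    have "?w\<^sup>2 = \<bar>m k\<bar> ^ p"
      by (simp add: power2_eq_square flip: power_mult_distrib abs_mult)
    then have W: "?w\<^sup>2 \<le> C * v k powr (s - real CARD('n))"
      using C(2)[of "freq k"] by (simp add: m_def v_def)
    have "0 \<le> ?w * ?a" by simp
    have "2 * (?w * ?a) = 2 * ((v k powr (s / 2) * ?a) * (v k powr (- s / 2) * ?w))"
      using v[of k] by (simp add: powr_minus)
    also have "\<dots> \<le> (v k powr (s / 2) * ?a)\<^sup>2 + (v k powr (- s / 2) * ?w)\<^sup>2"
      using sum_squares_bound[of "v k powr (s / 2) * ?a" "v k powr (- s / 2) * ?w"] by (simp add: mult.assoc)
    also have "\<dots> = v k powr s * ?a\<^sup>2 + v k powr (- s) * ?w\<^sup>2"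
      using v[of k] by (simp add: power_mult_distrib powr_power)
    also have "\<dots> \<le> v k powr s * ?a\<^sup>2 + v k powr (- s) * (C * v k powr (s - real CARD('n)))"
      by (intro add_left_mono mult_left_mono W) auto
    also have "\<dots> = v k powr s * ?a\<^sup>2 + C * v k powr (- real CARD('n))"
      by (simp flip: powr_add)
    finally show "\<bar>sqrt (- multiplier \<delta> (real CARD('n)) (freq k))\<bar> ^ p * ?a
        \<le> v k powr s * ?a\<^sup>2 + C * v k powr (- real CARD('n))"
      using \<open>0 \<le> ?w * ?a\<close> unfolding m_def by linarith
  qed simp
qed

section \<open>Term-by-term differentiation of infinite sums\<close>

lemma has_vector_derivative_iff_tendsto:
  fixes f :: "real \<Rightarrow> 'b :: real_normed_vector"
  shows "(f has_vector_derivative D) (at t within S) \<longleftrightarrow>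
    ((\<lambda>s. (f s - f t) /\<^sub>R (s - t)) \<longlongrightarrow> D) (at t within S)"
proof -
  have "norm (f s - f t - (s - t) *\<^sub>R D) / norm (s - t) = norm ((f s - f t) /\<^sub>R (s - t) - D)"
    if "s \<noteq> t" for s
  proof -
    have "(f s - f t) /\<^sub>R (s - t) - D = (f s - f t - (s - t) *\<^sub>R D) /\<^sub>R (s - t)"
      using that by (simp add: scaleR_diff_right)
    then show ?thesis by (simp add: divide_inverse mult.commute)
  qed
  then have "((\<lambda>s. norm (f s - f t - (s - t) *\<^sub>R D) / norm (s - t)) \<longlongrightarrow> 0) (at t within S) \<longleftrightarrow>
      ((\<lambda>s. norm ((f s - f t) /\<^sub>R (s - t) - D)) \<longlongrightarrow> 0) (at t within S)"
    by (intro tendsto_cong) (auto simp: eventually_at_filter)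
  then show ?thesis
    by (simp add: has_vector_derivative_def has_derivative_iff_norm bounded_linear_scaleR_left
        tendsto_norm_zero_iff flip: LIM_zero_iff[of _ D])
qed

text \<open>On a convex set the mean value inequality bounds every difference quotient of
  \<open>h k\<close> by \<open>M k\<close>. The Weierstrass M-test then makes the sums of quotients
  converge uniformly in s, which allows the limit s -> t to be taken inside the sum.\<close>

lemma has_vector_derivative_infsum:
  fixes h h' :: "'i \<Rightarrow> real \<Rightarrow> 'b :: banach"
  assumes "convex S" and t: "t \<in> S"
    and d: "\<And>k s. k \<in> A \<Longrightarrow> s \<in> S \<Longrightarrow> (h k has_vector_derivative h' k s) (at s within S)"
    and le: "\<And>k s. k \<in> A \<Longrightarrow> s \<in> S \<Longrightarrow> norm (h' k s) \<le> M k"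
    and M: "M summable_on A"
    and sm: "\<And>s. s \<in> S \<Longrightarrow> (\<lambda>k. h k s) summable_on A"
  shows "((\<lambda>s. \<Sum>\<^sub>\<infinity>k\<in>A. h k s) has_vector_derivative (\<Sum>\<^sub>\<infinity>k\<in>A. h' k t)) (at t within S)"
proof -
  define q where "q k s = (h k s - h k t) /\<^sub>R (s - t)" for k s
  have q: "norm (q k s) \<le> M k" if k: "k \<in> A" and s: "s \<in> S - {t}" for k s
  proof -
    have "norm (h k s - h k t) \<le> M k * norm (s - t)"
    proof (rule differentiable_bound[OF \<open>convex S\<close>])
      fix x assume "x \<in> S"
      then show "(h k has_derivative (\<lambda>r. r *\<^sub>R h' k x)) (at x within S)"
        using d[OF k] by (simp add: has_vector_derivative_def)
      show "onorm (\<lambda>r. r *\<^sub>R h' k x) \<le> M k"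
        using le[OF k \<open>x \<in> S\<close>] by (intro onorm_le) (simp add: mult.commute mult_left_mono)
    qed (use s t in auto)
    then show ?thesis
      using s by (simp add: q_def divide_simps mult.commute)
  qed
  have "uniform_limit (S - {t}) (\<lambda>X s. \<Sum>k\<in>X. q k s) (\<lambda>s. \<Sum>\<^sub>\<infinity>k\<in>A. q k s) (finite_subsets_at_top A)"
    using q M by (rule Weierstrass_m_test_general)
  moreover have "\<forall>\<^sub>F X in finite_subsets_at_top A.
      ((\<lambda>s. \<Sum>k\<in>X. q k s) \<longlongrightarrow> (\<Sum>k\<in>X. h' k t)) (at t within S)"
  proof (rule eventually_finite_subsets_at_top_weakI)
    fix X assume X: "finite X" "X \<subseteq> A"
    show "((\<lambda>s. \<Sum>k\<in>X. q k s) \<longlongrightarrow> (\<Sum>k\<in>X. h' k t)) (at t within S)"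
      unfolding q_def
      by (intro tendsto_sum has_vector_derivative_iff_tendsto[THEN iffD1]) (use X d t in auto)
  qed
  moreover have "((\<lambda>X. \<Sum>k\<in>X. h' k t) \<longlongrightarrow> (\<Sum>\<^sub>\<infinity>k\<in>A. h' k t)) (finite_subsets_at_top A)"
    using abs_summable_summable[OF Infinite_Sum.abs_summable_on_comparison_test'[OF M le]] t
    by (auto intro: infsum_tendsto)
  ultimately have "((\<lambda>s. \<Sum>\<^sub>\<infinity>k\<in>A. q k s) \<longlongrightarrow> (\<Sum>\<^sub>\<infinity>k\<in>A. h' k t)) (at t within S)"
    by (intro swap_uniform_limit'[where S = "S - {t}"]) (auto simp: eventually_at_filter)
  moreover have "(\<Sum>\<^sub>\<infinity>k\<in>A. q k s) = ((\<Sum>\<^sub>\<infinity>k\<in>A. h k s) - (\<Sum>\<^sub>\<infinity>k\<in>A. h k t)) /\<^sub>R (s - t)"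
    if "s \<in> S" for s
  proof -
    have "((\<lambda>k. h k s - h k t) has_sum ((\<Sum>\<^sub>\<infinity>k\<in>A. h k s) - (\<Sum>\<^sub>\<infinity>k\<in>A. h k t))) A"
      unfolding diff_conv_add_uminus by (intro has_sum_add has_sum_infsum sm that) (simp add: has_sum_uminus sm t)
    then show ?thesis
      unfolding q_def by (intro infsumI has_sum_scaleR)
  qed
  then have "\<forall>\<^sub>F s in at t within S. (\<Sum>\<^sub>\<infinity>k\<in>A. q k s)
      = ((\<Sum>\<^sub>\<infinity>k\<in>A. h k s) - (\<Sum>\<^sub>\<infinity>k\<in>A. h k t)) /\<^sub>R (s - t)"
    by (auto simp: eventually_at_filter)
  ultimately have "((\<lambda>s. ((\<Sum>\<^sub>\<infinity>k\<in>A. h k s) - (\<Sum>\<^sub>\<infinity>k\<in>A. h k t)) /\<^sub>R (s - t))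
      \<longlongrightarrow> (\<Sum>\<^sub>\<infinity>k\<in>A. h' k t)) (at t within S)"
    by (rule Lim_transform_eventually)
  then show ?thesis
    by (simp only: has_vector_derivative_iff_tendsto)
qed

section \<open>Derivatives and bounds for one Fourier mode\<close>

text \<open>The \<open>j\<close>-th derivative of \<^term>\<open>\<lambda>t. a * cos (w * t) + c / w * sin (w * t)\<close>,
  also for \<open>w = 0\<close>, where \<open>c / w = 0\<close>.\<close>

definition oscillation :: "complex \<Rightarrow> complex \<Rightarrow> real \<Rightarrow> nat \<Rightarrow> real \<Rightarrow> complex" where
  "oscillation a c w j t = of_real (w ^ j) *
     (a * of_real (cos (w * t + real j * (pi / 2))) +
      c / of_real w * of_real (sin (w * t + real j * (pi / 2))))"

text \<open>Each derivative contributes a factor w and adds pi/2 to the phase, which avoids a case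
  distinction modulo 4.\<close>

lemma oscillation_has_vector_derivative:
  "(oscillation a c w j has_vector_derivative oscillation a c w (Suc j) t) (at t within S)"
proof -
  let ?\<theta> = "w * t + real j * (pi / 2)"
  have s: "w * t + real (Suc j) * (pi / 2) = ?\<theta> + pi / 2"
    by (simp add: algebra_simps add_divide_distrib)
  have Suc: "oscillation a c w (Suc j) t =
      of_real (w ^ j) * (a * of_real (- sin ?\<theta> * w) + c / of_real w * of_real (cos ?\<theta> * w))"
    unfolding oscillation_def s by (simp add: cos_add sin_add algebra_simps)
  have "((\<lambda>t. of_real (w ^ j) *
     (a * of_real (cos (w * t + real j * (pi / 2))) +
      c / of_real w * of_real (sin (w * t + real j * (pi / 2))))) has_vector_derivative
      of_real (w ^ j) * (a * of_real (- sin ?\<theta> * w) + c / of_real w * of_real (cos ?\<theta> * w))) (at t within S)"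
    by (intro has_vector_derivative_mult_right has_vector_derivative_add has_vector_derivative_of_real)
      (auto intro!: derivative_eq_intros simp flip: has_real_derivative_iff_has_vector_derivative)
  then show ?thesis
    unfolding Suc by (simp only: oscillation_def[abs_def])
qed

text \<open>In the sine term one factor w cancels for j >= 1, giving |w|^(j-1). For j = 0 the
  truncated exponent makes this power 1, and |t| bounds sin(w t)/w. The sum of both serves every
  j.\<close>

lemma oscillation_norm_le:
  "cmod (oscillation a c w j t) \<le> \<bar>w\<bar> ^ j * cmod a + (\<bar>w\<bar> ^ (j - 1) + \<bar>t\<bar>) * cmod c"
proof -
  let ?\<theta> = "w * t + real j * (pi / 2)"
  have c: "\<bar>w ^ j / w * sin ?\<theta>\<bar> \<le> \<bar>w\<bar> ^ (j - 1) + \<bar>t\<bar>"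
  proof (cases j)
    case 0
    have "\<bar>sin (w * t) / w\<bar> \<le> \<bar>t\<bar>"
      using abs_sin_x_le_abs_x[of "w * t"] by (auto simp: abs_mult divide_simps mult.commute)
    then show ?thesis using 0 by simp
  next
    case (Suc i)
    have "\<bar>w ^ j / w\<bar> \<le> \<bar>w\<bar> ^ i"
      using Suc by (simp add: power_abs)
    then have "\<bar>w ^ j / w\<bar> * \<bar>sin ?\<theta>\<bar> \<le> \<bar>w\<bar> ^ i * 1"
      by (intro mult_mono) auto
    then show ?thesis using Suc by (simp add: abs_mult)
  qed
  have "oscillation a c w j t = of_real (w ^ j * cos ?\<theta>) * a + of_real (w ^ j / w * sin ?\<theta>) * c"
    by (simp add: oscillation_def algebra_simps)
  also have "cmod \<dots> \<le> \<bar>w ^ j * cos ?\<theta>\<bar> * cmod a + \<bar>w ^ j / w * sin ?\<theta>\<bar> * cmod c"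
    by (intro norm_triangle_le add_mono) (simp_all only: norm_mult norm_of_real order_refl)
  also have "\<dots> \<le> \<bar>w\<bar> ^ j * cmod a + (\<bar>w\<bar> ^ (j - 1) + \<bar>t\<bar>) * cmod c"
  proof (intro add_mono mult_right_mono c)
    show "\<bar>w ^ j * cos ?\<theta>\<bar> \<le> \<bar>w\<bar> ^ j"
      unfolding abs_mult power_abs by (intro mult_left_le) auto
  qed auto
  finally show ?thesis .
qed

section \<open>Smoothness in time of the full Fourier series\<close>

theorem theorem13:
  fixes \<delta> \<beta> s1 s2 :: real
    and f g :: "(real ^ 'n \<Rightarrow> complex) \<Rightarrow> complex"
  assumes "\<delta> > 0"
    and "\<beta> = real CARD('n)"
    and "f \<in> sobolev s1" and "s1 > real CARD('n)"
    and "g \<in> sobolev s2" and "s2 > real CARD('n)"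
  shows "\<forall>x\<in>torus.
           (\<forall>t\<ge>0. solution_mode \<delta> \<beta> f g x t summable_on (UNIV - {0})) \<and>
           C_infinity_on {0..} (solution \<delta> \<beta> f g x)"
proof
  fix x :: "real ^ 'n"
  let ?A = "UNIV - {0 :: int ^ 'n}"
  define w :: "int ^ 'n \<Rightarrow> real" where "w k = sqrt (- multiplier \<delta> \<beta> (freq k))" for k
  \<comment> \<open>\<open>u j k\<close> is the j-th time derivative of mode k, and
    \<open>M j T k\<close> majorizes it for |t| <= T.\<close>
  define u where "u j k t = oscillation (fourier_coeff f k) (fourier_coeff g k) (w k) j t * cis (freq k \<bullet> x)"
    for j k t
  define M where "M j T k = \<bar>w k\<bar> ^ j * cmod (fourier_coeff f k)
      + (\<bar>w k\<bar> ^ (j - 1) + T) * cmod (fourier_coeff g k)" for j T k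
  have sf: "(\<lambda>k. \<bar>w k\<bar> ^ p * cmod (fourier_coeff f k)) summable_on UNIV" for p
    unfolding w_def assms(2) using assms by (intro sobolev_weighted_coeffs_summable[where s = s1]) auto
  have sg: "(\<lambda>k. \<bar>w k\<bar> ^ p * cmod (fourier_coeff g k)) summable_on UNIV" for p
    unfolding w_def assms(2) using assms by (intro sobolev_weighted_coeffs_summable[where s = s2]) auto
  have sg0: "(\<lambda>k. cmod (fourier_coeff g k)) summable_on UNIV"
    using sg[of 0] by simp
  have "M j T summable_on UNIV" for j T
    unfolding M_def distrib_right
    by (intro summable_on_add sf sg summable_on_cmult_right sg0)
  then have M: "M j T summable_on ?A" for j T
    by (rule summable_on_subset) auto
  have le: "cmod (u j k t) \<le> M j T k" if "\<bar>t\<bar> \<le> T" for j k t T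
  proof -
    have "cmod (u j k t) \<le> M j \<bar>t\<bar> k"
      using oscillation_norm_le by (simp add: u_def M_def norm_mult)
    also have "\<dots> \<le> M j T k"
      unfolding M_def using that by (intro add_left_mono mult_right_mono) auto
    finally show ?thesis .
  qed
  have sm: "(\<lambda>k. u j k t) summable_on ?A" for j t
    by (rule abs_summable_summable[OF Infinite_Sum.abs_summable_on_comparison_test'[OF M[of j "\<bar>t\<bar>"]]])
      (rule le[OF order_refl])
  have du: "(u j k has_vector_derivative u (Suc j) k t) (at t within S)" for j k t S
    unfolding u_def[abs_def]
    by (intro has_vector_derivative_mult_left oscillation_has_vector_derivative)
  have mode: "solution_mode \<delta> \<beta> f g x t k = u 0 k t" for t k
    by (simp add: solution_mode_def u_def oscillation_def w_def Let_def)
  have "((\<lambda>s. \<Sum>\<^sub>\<infinity>k\<in>?A. u j k s) has_vector_derivative (\<Sum>\<^sub>\<infinity>k\<in>?A. u (Suc j) k t)) (at t)" for j t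
  proof -
    \<comment> \<open>The majorant is uniform only over bounded times, so each t gets its own
      bounded interval; as this is open, the derivative is two-sided and can be restricted to
      \<open>{0..}\<close> afterwards.\<close>
    let ?T = "\<bar>t\<bar> + 1"
    have "((\<lambda>s. \<Sum>\<^sub>\<infinity>k\<in>?A. u j k s) has_vector_derivative (\<Sum>\<^sub>\<infinity>k\<in>?A. u (Suc j) k t))
        (at t within {- ?T<..<?T})"
      by (rule has_vector_derivative_infsum[where M = "M (Suc j) ?T"]) (auto intro: du le M sm)
    then show ?thesis
      by (subst (asm) at_within_open) auto
  qed
  note dinf = has_vector_derivative_at_within[OF this]
  \<comment> \<open>\<open>P j\<close> is the j-th derivative of the affine part, which comes from k
    = 0.\<close>
  define P where "P j t = (if j = 0 then fourier_coeff f 0 + fourier_coeff g 0 * of_real t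
      else if j = 1 then fourier_coeff g 0 else 0)" for j :: nat and t
  have dP: "(P j has_vector_derivative P (Suc j) t) (at t within S)" for j t S
  proof -
    consider "j = 0" | "j = 1" | "j \<ge> 2" by linarith
    then show ?thesis
    proof cases
      case 1
      have "((\<lambda>t. fourier_coeff f 0 + fourier_coeff g 0 * of_real t) has_vector_derivative
          0 + fourier_coeff g 0 * of_real 1) (at t within S)"
        by (intro has_vector_derivative_add has_vector_derivative_const has_vector_derivative_mult_right
            has_vector_derivative_of_real DERIV_ident)
      then show ?thesis using 1 by (simp add: P_def[abs_def])
    qed (auto simp: P_def[abs_def])
  qed
  have "C_infinity_on {0..} (solution \<delta> \<beta> f g x)"
    unfolding C_infinity_on_def
  proof (intro exI conjI allI ballI)
    show "(\<lambda>t. P 0 t + (\<Sum>\<^sub>\<infinity>k\<in>?A. u 0 k t)) = solution \<delta> \<beta> f g x"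
      by (simp add: fun_eq_iff solution_def mode P_def)
    show "((\<lambda>t. P j t + (\<Sum>\<^sub>\<infinity>k\<in>?A. u j k t)) has_vector_derivative
        (P (Suc j) t + (\<Sum>\<^sub>\<infinity>k\<in>?A. u (Suc j) k t))) (at t within {0..})" for j t
      by (intro has_vector_derivative_add dP dinf)
  qed
  then show "(\<forall>t\<ge>0. solution_mode \<delta> \<beta> f g x t summable_on ?A) \<and>
      C_infinity_on {0..} (solution \<delta> \<beta> f g x)"
    using sm[of 0] by (simp add: mode[abs_def])
qed

end
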